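(* Let $(A,\mu)$ be a partially crossed topological $G$-$R$-bimodule and let $N$ be a normal subgroup of $G$. Then there is an exact sequence (of pointed sets) $$1\to H^{1}(G/N,(A^{N},\mu^{N}))\xrightarrow{\mathrm{Inf}^{1}} H^{1}(G,(A,\mu))\xrightarrow{\mathrm{Res}^{1}} H^{1}(N,(A,\mu))^{G/N}.$$
   Context: Topological groups are not assumed abelian. A topological $G$-module is a topological group $A$ with a continuous left action of the topological group $G$ on $A$ by group automorphisms, written ${}^{g}a$. Every group acts on itself by conjugation, so ${}^{a}b=aba^{-1}$ for $a,b$ in the same group. A precrossed topological $R$-module $(A,\mu)$ is a topological $R$-module $A$ with a continuous homomorphism $\mu:A\to R$ such that $\mu({}^{r}a)=r\mu(a)r^{-1}$. It is partially crossed if ${}^{\mu(a)}b=aba^{-1}$ for all $b\in A$ and all $a\in A$ with $\mu(a)\in[R,R]$. A partially crossed topological $G$-$R$-bimodule is a partially crossed topological $R$-module $(A,\mu)$ such that the topological group $G$ acts continuously on $R$ and $A$ (by automorphisms), $\mu({}^{g}a)={}^{g}\mu(a)$, and ${}^{({}^{g}r)}a={}^{g}({}^{r}({}^{g^{-1}}a))$ for all $g\in G,r\in R,a\in A$. $Der_{c}(G,(A,\mu))$ is the set of pairs $(\alpha,r)$ with $\alpha:G\to A$ a continuous map satisfying $\alpha(gh)=\alpha(g)\,{}^{g}\alpha(h)$ (a crossed homomorphism) and $r\in R$ such that $\mu(\alpha(g))=r\,{}^{g}r^{-1}$ for all $g\in G$. $H^0(G,R)=\{r\in R: {}^{g}r=r\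 \forall g\in G\}$. Put $(\alpha,r)\sim'(\beta,s)$ if there is $a\in A$ with $\beta(g)=a^{-1}\alpha(g)\,{}^{g}a$ for all $g\in G$ and $s\in\mu(a)^{-1}rH^{0}(G,R)$. $H^{1}(G,(A,\mu))$ is the quotient set $Der_{c}(G,(A,\mu))/\!\sim'$, with base point the class of $(\mathbf 1,1)$, $\mathbf 1$ being the trivial homomorphism. For $N$ normal in $G$: $A^N$, $R^N$ are the subgroups of elements fixed by $N$; $\mu^N:A^N\to R^N$ is the restriction of $\mu$; $(A^N,\mu^N)$ is a partially crossed topological $G/N$-$R^N$-bimodule; $(A,\mu)$ is a partially crossed topological $N$-$R$-bimodule by restriction. With $\pi:G\to G/N$ the quotient map, $\mathrm{Inf}^1[(\alpha,r)]=[(\alpha\circ\pi,r)]$ (with $\alpha\circ\pi$ viewed as a map into $A$ and $r$ as an element of $R$), and $\mathrm{Res}^1[(\alpha,r)]=[(\alpha|_N,r)]$. $G/N$ acts on $H^1(N,(A,\mu))$ by ${}^{gN}[(\alpha,r)]=[(\tilde\alpha,{}^{g}r)]$, where $\tilde\alpha(n)={}^{g}\alpha(g^{-1}ng)$; $H^{1}(N,(A,\mu))^{G/N}$ is the set of fixed points. Exactness is exactness of pointed sets (kernel = preimage of the base point). *)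

theory Defs
  imports "HOL-Algebra.Bij" "HOL-Algebra.Generated_Groups" "HOL-Analysis.Product_Topology"
begin

section \<open>Topological groups, subgroups and quotients\<close>

record 'a topgroup = "'a monoid" +
  topo :: "'a topology"

text \<open>No separation axiom is imposed, and the normal subgroup in the theorem need not be closed.\<close>

locale topological_group = group G for G :: "'a topgroup" (structure) +
  assumes topspace_eq: "topspace (topo G) = carrier G"
    and continuous_mult:
      "continuous_map (prod_topology (topo G) (topo G)) (topo G) (\<lambda>(x, y). x \<otimes> y)"
    and continuous_inv: "continuous_map (topo G) (topo G) (\<lambda>x. inv x)"

definition sub_topgroup :: "'a topgroup \<Rightarrow> 'a set \<Rightarrow> 'a topgroup" where
  "sub_topgroup G H = G\<lparr>carrier := H, topo := subtopology (topo G) H\<rparr>"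

definition quotient_topology :: "'a topology \<Rightarrow> ('a \<Rightarrow> 'b) \<Rightarrow> 'b topology" where
  "quotient_topology X f =
     topology (\<lambda>U. U \<subseteq> f ` topspace X \<and> openin X {x \<in> topspace X. f x \<in> U})"

lemma openin_quotient_topology:
  "openin (quotient_topology X f) U \<longleftrightarrow>
     U \<subseteq> f ` topspace X \<and> openin X {x \<in> topspace X. f x \<in> U}"
proof -
  have "istopology (\<lambda>U. U \<subseteq> f ` topspace X \<and> openin X {x \<in> topspace X. f x \<in> U})"
  proof -
    have *: "{x \<in> topspace X. f x \<in> S \<inter> T} =
        {x \<in> topspace X. f x \<in> S} \<inter> {x \<in> topspace X. f x \<in> T}" for S T
      by auto
    have **: "{x \<in> topspace X. f x \<in> \<Union>K} = (\<Union>S\<in>K. {x \<in> topspace X. f x \<in> S})" for K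
      by auto
    show ?thesis
      unfolding istopology_def * ** by (auto intro!: openin_Union)
  qed
  then show ?thesis
    by (simp add: quotient_topology_def topology_inverse')
qed

lemma quotient_map_quotient_topology: "quotient_map X (quotient_topology X f) f"
proof -
  have "openin (quotient_topology X f) (f ` topspace X)"
    by (auto simp: openin_quotient_topology intro!: rev_iffD1 [OF openin_topspace arg_cong [of _ _ "openin X"]])
  then have "topspace (quotient_topology X f) = f ` topspace X"
    by (metis openin_quotient_topology openin_subset openin_topspace subset_antisym)
  then show ?thesis
    by (auto simp: quotient_map_def openin_quotient_topology)
qed

definition quot_topgroup :: "'a topgroup \<Rightarrow> 'a set \<Rightarrow> 'a set topgroup" where
  "quot_topgroup G N =
     \<lparr>carrier = carrier (G Mod N), mult = mult (G Mod N), one = one (G Mod N),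
      topo = quotient_topology (topo G) (\<lambda>g. N #>\<^bsub>G\<^esub> g)\<rparr>"


section \<open>Topological modules and partially crossed bimodules\<close>

locale topological_module = G: topological_group G + A: topological_group A
  for G :: "'g topgroup" and A :: "'a topgroup" +
  fixes act :: "'g \<Rightarrow> 'a \<Rightarrow> 'a"
  assumes act_hom: "act \<in> hom G (AutoGroup A)"
    and act_continuous:
      "continuous_map (prod_topology (topo G) (topo A)) (topo A) (\<lambda>(g, a). act g a)"

locale precrossed_module = topological_module R A act
  for R :: "'r topgroup" and A :: "'a topgroup" and act +
  fixes \<mu> :: "'a \<Rightarrow> 'r"
  assumes mu_hom: "\<mu> \<in> hom A R"
    and mu_continuous: "continuous_map (topo A) (topo R) \<mu>"
    and mu_act: "\<lbrakk>r \<in> carrier R; a \<in> carrier A\<rbrakk> \<Longrightarrow>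
      \<mu> (act r a) = r \<otimes>\<^bsub>R\<^esub> \<mu> a \<otimes>\<^bsub>R\<^esub> inv\<^bsub>R\<^esub> r"

locale partially_crossed_module = precrossed_module R A act \<mu>
  for R :: "'r topgroup" and A :: "'a topgroup" and act \<mu> +
  assumes peiffer: "\<lbrakk>a \<in> carrier A; b \<in> carrier A; \<mu> a \<in> derived R (carrier R)\<rbrakk> \<Longrightarrow>
      act (\<mu> a) b = a \<otimes>\<^bsub>A\<^esub> b \<otimes>\<^bsub>A\<^esub> inv\<^bsub>A\<^esub> a"

text \<open>The data of a \<open>G\<close>-\<open>R\<close>-bimodule \<open>(A, \<mu>)\<close>: both groups, the map \<open>\<mu>\<close>, and the actions of
  \<open>R\<close> on \<open>A\<close>, of \<open>G\<close> on \<open>R\<close>, and of \<open>G\<close> on \<open>A\<close>. Only the values of the action maps at elements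
  of the acting group matter, so the same record also serves as an \<open>N\<close>-\<open>R\<close>-bimodule for a
  subgroup \<open>N\<close> of \<open>G\<close>.\<close>

record ('g, 'r, 'a) bimodule =
  base_grp :: "'r topgroup"
  mod_grp :: "'a topgroup"
  bmap :: "'a \<Rightarrow> 'r"
  act_RA :: "'r \<Rightarrow> 'a \<Rightarrow> 'a"
  act_GR :: "'g \<Rightarrow> 'r \<Rightarrow> 'r"
  act_GA :: "'g \<Rightarrow> 'a \<Rightarrow> 'a"

locale partially_crossed_bimodule =
  partially_crossed_module "base_grp M" "mod_grp M" "act_RA M" "bmap M" +
  GR: topological_module G "base_grp M" "act_GR M" +
  GA: topological_module G "mod_grp M" "act_GA M"
  for G :: "'g topgroup" and M :: "('g, 'r, 'a) bimodule" +
  assumes bmap_equivariant: "\<lbrakk>g \<in> carrier G; a \<in> carrier (mod_grp M)\<rbrakk> \<Longrightarrow>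
      bmap M (act_GA M g a) = act_GR M g (bmap M a)"
    and act_compatible:
      "\<lbrakk>g \<in> carrier G; r \<in> carrier (base_grp M); a \<in> carrier (mod_grp M)\<rbrakk> \<Longrightarrow>
      act_RA M (act_GR M g r) a = act_GA M g (act_RA M r (act_GA M (inv\<^bsub>G\<^esub> g) a))"

definition fixed_points :: "'g set \<Rightarrow> ('g \<Rightarrow> 'e \<Rightarrow> 'e) \<Rightarrow> 'e set \<Rightarrow> 'e set" where
  "fixed_points S act E = {x \<in> E. \<forall>g\<in>S. act g x = x}"

text \<open>The \<open>G/N\<close>-\<open>R\<^sup>N\<close>-bimodule \<open>(A\<^sup>N, \<mu>\<^sup>N)\<close>. A coset acts as any of its elements does; these all agree
  on points fixed by \<open>N\<close>. The restrictions are needed because automorphisms in \<^const>\<open>AutoGroup\<close> are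
  extensional.\<close>

definition fixed_bimodule :: "'g set \<Rightarrow> ('g, 'r, 'a) bimodule \<Rightarrow> ('g set, 'r, 'a) bimodule" where
  "fixed_bimodule N M =
     (let RN = fixed_points N (act_GR M) (carrier (base_grp M));
          AN = fixed_points N (act_GA M) (carrier (mod_grp M))
      in \<lparr>base_grp = sub_topgroup (base_grp M) RN,
          mod_grp = sub_topgroup (mod_grp M) AN,
          bmap = restrict (bmap M) AN,
          act_RA = (\<lambda>r. restrict (act_RA M r) AN),
          act_GR = (\<lambda>C. \<lambda>x\<in>RN. the_elem ((\<lambda>g. act_GR M g x) ` C)),
          act_GA = (\<lambda>C. \<lambda>x\<in>AN. the_elem ((\<lambda>g. act_GA M g x) ` C))\<rparr>)"


section \<open>Cohomology\<close>

definition H0 :: "'g topgroup \<Rightarrow> ('g, 'r, 'a) bimodule \<Rightarrow> 'r set" where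
  "H0 G M = fixed_points (carrier G) (act_GR M) (carrier (base_grp M))"

text \<open>Maps defined on \<open>G\<close> are represented by functions that are extensional on its carrier.\<close>

definition Der_c :: "'g topgroup \<Rightarrow> ('g, 'r, 'a) bimodule \<Rightarrow> (('g \<Rightarrow> 'a) \<times> 'r) set" where
  "Der_c G M = {(\<alpha>, r).
     \<alpha> \<in> extensional (carrier G) \<and>
     continuous_map (topo G) (topo (mod_grp M)) \<alpha> \<and>
     (\<forall>g\<in>carrier G. \<forall>h\<in>carrier G.
        \<alpha> (g \<otimes>\<^bsub>G\<^esub> h) = \<alpha> g \<otimes>\<^bsub>mod_grp M\<^esub> act_GA M g (\<alpha> h)) \<and>
     r \<in> carrier (base_grp M) \<and>
     (\<forall>g\<in>carrier G.
        bmap M (\<alpha> g) = r \<otimes>\<^bsub>base_grp M\<^esub> act_GR M g (inv\<^bsub>base_grp M\<^esub> r))}"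

definition Der_rel ::
    "'g topgroup \<Rightarrow> ('g, 'r, 'a) bimodule \<Rightarrow> ((('g \<Rightarrow> 'a) \<times> 'r) \<times> (('g \<Rightarrow> 'a) \<times> 'r)) set" where
  "Der_rel G M = {((\<alpha>, r), (\<beta>, s)).
     (\<alpha>, r) \<in> Der_c G M \<and> (\<beta>, s) \<in> Der_c G M \<and>
     (\<exists>a\<in>carrier (mod_grp M).
        (\<forall>g\<in>carrier G.
           \<beta> g = inv\<^bsub>mod_grp M\<^esub> a \<otimes>\<^bsub>mod_grp M\<^esub> \<alpha> g \<otimes>\<^bsub>mod_grp M\<^esub> act_GA M g a) \<and>
        s \<in> (inv\<^bsub>base_grp M\<^esub> (bmap M a) \<otimes>\<^bsub>base_grp M\<^esub> r) <#\<^bsub>base_grp M\<^esub> H0 G M)}"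

definition H1 :: "'g topgroup \<Rightarrow> ('g, 'r, 'a) bimodule \<Rightarrow> (('g \<Rightarrow> 'a) \<times> 'r) set set" where
  "H1 G M = Der_c G M // Der_rel G M"

definition H1_class ::
    "'g topgroup \<Rightarrow> ('g, 'r, 'a) bimodule \<Rightarrow> ('g \<Rightarrow> 'a) \<times> 'r \<Rightarrow> (('g \<Rightarrow> 'a) \<times> 'r) set" where
  "H1_class G M x = Der_rel G M `` {x}"

definition H1_base :: "'g topgroup \<Rightarrow> ('g, 'r, 'a) bimodule \<Rightarrow> (('g \<Rightarrow> 'a) \<times> 'r) set" where
  "H1_base G M = H1_class G M (\<lambda>g\<in>carrier G. \<one>\<^bsub>mod_grp M\<^esub>, \<one>\<^bsub>base_grp M\<^esub>)"

text \<open>The maps below are given by formulas on representatives. Since \<^const>\<open>the_elem\<close> has a specified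
  value only on singletons, it yields a class only if all representatives give that same class;
  and as \<^const>\<open>H1_class\<close> is empty outside \<^const>\<open>Der_c\<close>, a value in \<^const>\<open>H1\<close> moreover means that all the
  pairs given by the formula lie in \<^const>\<open>Der_c\<close>.\<close>

definition Inf1 ::
    "'g topgroup \<Rightarrow> 'g set \<Rightarrow> ('g, 'r, 'a) bimodule \<Rightarrow>
     (('g set \<Rightarrow> 'a) \<times> 'r) set \<Rightarrow> (('g \<Rightarrow> 'a) \<times> 'r) set" where
  "Inf1 G N M c =
     the_elem ((\<lambda>(\<alpha>, r). H1_class G M (compose (carrier G) \<alpha> (\<lambda>g. N #>\<^bsub>G\<^esub> g), r)) ` c)"

definition Res1 ::
    "'g topgroup \<Rightarrow> 'g set \<Rightarrow> ('g, 'r, 'a) bimodule \<Rightarrow>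
     (('g \<Rightarrow> 'a) \<times> 'r) set \<Rightarrow> (('g \<Rightarrow> 'a) \<times> 'r) set" where
  "Res1 G N M c = the_elem ((\<lambda>(\<alpha>, r). H1_class (sub_topgroup G N) M (restrict \<alpha> N, r)) ` c)"

definition H1_act ::
    "'g topgroup \<Rightarrow> 'g set \<Rightarrow> ('g, 'r, 'a) bimodule \<Rightarrow>
     'g set \<Rightarrow> (('g \<Rightarrow> 'a) \<times> 'r) set \<Rightarrow> (('g \<Rightarrow> 'a) \<times> 'r) set" where
  "H1_act G N M C c =
     the_elem ((\<lambda>(g, \<alpha>, r). H1_class (sub_topgroup G N) M
       (\<lambda>n\<in>N. act_GA M g (\<alpha> (inv\<^bsub>G\<^esub> g \<otimes>\<^bsub>G\<^esub> n \<otimes>\<^bsub>G\<^esub> g)), act_GR M g r)) ` (C \<times> c))"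

definition H1_fixed ::
    "'g topgroup \<Rightarrow> 'g set \<Rightarrow> ('g, 'r, 'a) bimodule \<Rightarrow> (('g \<Rightarrow> 'a) \<times> 'r) set set" where
  "H1_fixed G N M =
     fixed_points (carrier (quot_topgroup G N)) (H1_act G N M) (H1 (sub_topgroup G N) M)"


section \<open>Exactness of pointed sets\<close>

text \<open>A pointed set is a pair of a set and its base point.\<close>

definition H1_pointed ::
    "'g topgroup \<Rightarrow> ('g, 'r, 'a) bimodule \<Rightarrow>
     (('g \<Rightarrow> 'a) \<times> 'r) set set \<times> (('g \<Rightarrow> 'a) \<times> 'r) set" where
  "H1_pointed G M = (H1 G M, H1_base G M)"

definition H1_fixed_pointed ::
    "'g topgroup \<Rightarrow> 'g set \<Rightarrow> ('g, 'r, 'a) bimodule \<Rightarrow>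
     (('g \<Rightarrow> 'a) \<times> 'r) set set \<times> (('g \<Rightarrow> 'a) \<times> 'r) set" where
  "H1_fixed_pointed G N M = (H1_fixed G N M, H1_base (sub_topgroup G N) M)"

definition pointed_map :: "'a set \<times> 'a \<Rightarrow> ('a \<Rightarrow> 'b) \<Rightarrow> 'b set \<times> 'b \<Rightarrow> bool" where
  "pointed_map X f Y \<longleftrightarrow>
     snd X \<in> fst X \<and> snd Y \<in> fst Y \<and> f \<in> fst X \<rightarrow> fst Y \<and> f (snd X) = snd Y"

definition exact_at ::
    "'a set \<times> 'a \<Rightarrow> ('a \<Rightarrow> 'b) \<Rightarrow> 'b set \<times> 'b \<Rightarrow> ('b \<Rightarrow> 'c) \<Rightarrow> 'c set \<times> 'c \<Rightarrow> bool" where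
  "exact_at X f Y g Z \<longleftrightarrow>
     pointed_map X f Y \<and> pointed_map Y g Z \<and> f ` fst X = {y \<in> fst Y. g y = snd Z}"

end

theory Submission
  imports Defs
begin

text \<open>The condition on \<open>s\<close> in the relation \<open>(\<alpha>, r) \<sim>' (\<beta>, s)\<close> is automatic, so two pairs are
  equivalent iff some \<open>a\<close> twists \<open>\<alpha>\<close> into \<open>\<beta>\<close>. An \<open>a\<close> relating two inflated cocycles, which are
  trivial on \<open>N\<close>, is fixed by \<open>N\<close>; hence inflation is even injective. If \<open>\<alpha>\<close> restricts to a
  coboundary on \<open>N\<close>, twisting makes it trivial on \<open>N\<close>; normality of \<open>N\<close> then makes it constant
  on cosets with values in \<open>A\<^sup>N\<close>, so it descends to \<open>G/N\<close>, continuously since \<open>G \<rightarrow> G/N\<close> is a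
  quotient map.\<close>

section \<open>Actions by automorphisms\<close>

text \<open>Records only the algebra of an action, with laws demanded on the carriers alone, so that
  it passes to \<open>N\<close> and to \<open>G/N\<close> without any continuity argument.\<close>

locale auto_action = G: group G + E: group E
  for G (structure) and E (structure) and act +
  assumes act_closed [simp, intro]: "\<lbrakk>g \<in> carrier G; x \<in> carrier E\<rbrakk> \<Longrightarrow> act g x \<in> carrier E"
    and act_mult: "\<lbrakk>g \<in> carrier G; x \<in> carrier E; y \<in> carrier E\<rbrakk> \<Longrightarrow>
      act g (x \<otimes>\<^bsub>E\<^esub> y) = act g x \<otimes>\<^bsub>E\<^esub> act g y"
    and act_id [simp]: "x \<in> carrier E \<Longrightarrow> act \<one>\<^bsub>G\<^esub> x = x"
    and act_act: "\<lbrakk>g \<in> carrier G; h \<in> carrier G; x \<in> carrier E\<rbrakk> \<Longrightarrow>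
      act (g \<otimes>\<^bsub>G\<^esub> h) x = act g (act h x)"
begin

lemma act_hom_self: "g \<in> carrier G \<Longrightarrow> group_hom E E (act g)"
  by unfold_locales (auto simp: hom_def act_mult)

lemma act_one [simp]: "g \<in> carrier G \<Longrightarrow> act g \<one>\<^bsub>E\<^esub> = \<one>\<^bsub>E\<^esub>"
  by (rule group_hom.hom_one [OF act_hom_self])

lemma act_inv: "\<lbrakk>g \<in> carrier G; x \<in> carrier E\<rbrakk> \<Longrightarrow> act g (inv\<^bsub>E\<^esub> x) = inv\<^bsub>E\<^esub> act g x"
  by (rule group_hom.hom_inv [OF act_hom_self])

lemma subgroup_fixed_points:
  assumes "S \<subseteq> carrier G"
  shows "subgroup (fixed_points S act (carrier E)) E"
  using assms by unfold_locales (auto simp: fixed_points_def act_mult act_inv subset_eq)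

text \<open>Normality: \<open>n g = g (g^-1 n g)\<close>, and the conjugate \<open>g^-1 n g\<close>
  lies in \<open>N\<close>, hence fixes \<open>x\<close>.\<close>

lemma fixed_points_stable:
  assumes "N \<lhd> G" "g \<in> carrier G" "x \<in> fixed_points N act (carrier E)"
  shows "act g x \<in> fixed_points N act (carrier E)"
proof -
  interpret N: normal N G by fact
  have x: "x \<in> carrier E" "\<And>n. n \<in> N \<Longrightarrow> act n x = x"
    using assms(3) by (auto simp: fixed_points_def)
  have "act n (act g x) = act g x" if n: "n \<in> N" for n
  proof -
    have nG: "n \<in> carrier G" using n by simp
    have "n \<otimes>\<^bsub>G\<^esub> g = g \<otimes>\<^bsub>G\<^esub> (inv\<^bsub>G\<^esub> g \<otimes>\<^bsub>G\<^esub> n \<otimes>\<^bsub>G\<^esub> g)"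
      using assms(2) nG by (simp add: G.m_assoc [symmetric])
    moreover have "inv\<^bsub>G\<^esub> g \<otimes>\<^bsub>G\<^esub> n \<otimes>\<^bsub>G\<^esub> g \<in> N"
      using N.inv_op_closed1 assms(2) n by blast
    ultimately show ?thesis
      using x assms(2) nG by (metis N.mem_carrier act_act)
  qed
  then show ?thesis using x assms(2) by (simp add: fixed_points_def)
qed

text \<open>Every \<open>h\<close> in the coset is \<open>n g\<close> with \<open>n\<close> in
  \<open>N\<close>, and \<open>act g x\<close> is again fixed by \<open>N\<close>; so the image is a
  singleton.\<close>

lemma coset_act_fixed_points:
  assumes "N \<lhd> G" "g \<in> carrier G" "x \<in> fixed_points N act (carrier E)"
  shows "the_elem ((\<lambda>h. act h x) ` (N #>\<^bsub>G\<^esub> g)) = act g x"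
proof -
  interpret N: normal N G by fact
  have x: "x \<in> carrier E" using assms(3) by (simp add: fixed_points_def)
  have "act n (act g x) = act g x" if "n \<in> N" for n
    using fixed_points_stable [OF assms] that by (simp add: fixed_points_def)
  then have "act h x = act g x" if "h \<in> N #>\<^bsub>G\<^esub> g" for h
    using that assms(2) x by (auto simp: r_coset_def act_act)
  moreover have "g \<in> N #>\<^bsub>G\<^esub> g"
    using N.is_subgroup assms(2) by (rule G.rcos_self [rotated])
  ultimately have "(\<lambda>h. act h x) ` (N #>\<^bsub>G\<^esub> g) = {act g x}" by blast
  then show ?thesis by simp
qed

end

section \<open>Subgroups, quotient groups and the actions they inherit\<close>

lemma sub_topgroup_simps [simp]:
  "carrier (sub_topgroup G H) = H" "mult (sub_topgroup G H) = mult G"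
  "one (sub_topgroup G H) = one G" "topo (sub_topgroup G H) = subtopology (topo G) H"
  by (simp_all add: sub_topgroup_def)

lemma group_sub_topgroup:
  assumes "group G" "subgroup H G"
  shows "group (sub_topgroup G H)"
  using subgroup.subgroup_is_group [OF assms(2,1)]
  \<comment> \<open>Only carrier, product and unit enter these axioms, so the differing topology
    field does no harm.\<close>
  unfolding group_def group_axioms_def monoid_def Units_def by simp

lemma inv_sub_topgroup:
  assumes "group G" "subgroup H G" "x \<in> H"
  shows "inv\<^bsub>sub_topgroup G H\<^esub> x = inv\<^bsub>G\<^esub> x"
  using group.m_inv_consistent [OF assms] by (simp add: m_inv_def)

lemma quot_topgroup_simps [simp]:
  "carrier (quot_topgroup G N) = rcosets\<^bsub>G\<^esub> N" "mult (quot_topgroup G N) = set_mult G"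
  "one (quot_topgroup G N) = N"
  "topo (quot_topgroup G N) = quotient_topology (topo G) (\<lambda>g. N #>\<^bsub>G\<^esub> g)"
  by (simp_all add: quot_topgroup_def FactGroup_def)

lemma group_quot_topgroup:
  assumes "N \<lhd> G"
  shows "group (quot_topgroup G N)"
  using normal.factorgroup_is_group [OF assms]
  unfolding group_def group_axioms_def monoid_def Units_def by (simp add: FactGroup_def)

lemma auto_action_restrict:
  assumes "auto_action G E act" "subgroup H G"
  shows "auto_action (sub_topgroup G H) E act"
proof -
  interpret auto_action G E act by fact
  interpret H: group "sub_topgroup G H"
    using G.is_group assms(2) by (rule group_sub_topgroup)
  show ?thesis
    by unfold_locales (auto simp: act_mult act_act subgroup.mem_carrier [OF assms(2)])
qed

text \<open>On points fixed by \<open>N\<close> a coset acts as any of its representatives, so each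
  law reduces to the law for \<open>G\<close> once representatives are chosen.\<close>

lemma auto_action_quotient:
  assumes "auto_action G E act" "N \<lhd> G"
  defines "EN \<equiv> fixed_points N act (carrier E)"
  shows "auto_action (quot_topgroup G N) (sub_topgroup E EN)
    (\<lambda>C. \<lambda>x\<in>EN. the_elem ((\<lambda>g. act g x) ` C))" (is "auto_action _ _ ?act")
proof -
  interpret auto_action G E act by fact
  interpret N: normal N G by fact
  interpret Q: group "quot_topgroup G N" by (rule group_quot_topgroup) fact
  have sub: "subgroup EN E"
    unfolding EN_def by (intro subgroup_fixed_points N.subset)
  interpret S: group "sub_topgroup E EN"
    using E.is_group sub by (rule group_sub_topgroup)
  have act_coset: "?act (N #>\<^bsub>G\<^esub> g) x = act g x" if "g \<in> carrier G" "x \<in> EN" for g x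
    using that coset_act_fixed_points [OF assms(2)] by (simp add: EN_def)
  have stable: "act g x \<in> EN" if "g \<in> carrier G" "x \<in> EN" for g x
    using that fixed_points_stable [OF assms(2)] by (simp add: EN_def)
  have EN: "x \<in> carrier E" if "x \<in> EN" for x
    using that by (simp add: EN_def fixed_points_def)
  show ?thesis
  proof (unfold_locales, simp_all only: sub_topgroup_simps quot_topgroup_simps)
    fix C x assume "C \<in> rcosets\<^bsub>G\<^esub> N" and x: "x \<in> EN"
    then obtain g where "g \<in> carrier G" "C = N #>\<^bsub>G\<^esub> g" by (auto simp: RCOSETS_def)
    then show "?act C x \<in> EN" using x by (simp only: act_coset stable)
  next
    fix C x y assume "C \<in> rcosets\<^bsub>G\<^esub> N" and x: "x \<in> EN" "y \<in> EN"
    then obtain g where "g \<in> carrier G" "C = N #>\<^bsub>G\<^esub> g" by (auto simp: RCOSETS_def)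
    then show "?act C (x \<otimes>\<^bsub>E\<^esub> y) = ?act C x \<otimes>\<^bsub>E\<^esub> ?act C y"
      using x subgroup.m_closed [OF sub x] by (simp only: act_coset act_mult EN)
  next
    fix x assume x: "x \<in> EN"
    show "?act N x = x"
      \<comment> \<open>The unit of the quotient is \<open>N\<close> itself, read here as the coset
        of the unit of \<open>G\<close>.\<close>
      using act_coset [OF G.one_closed x] x EN N.subset by simp
  next
    fix C D x assume "C \<in> rcosets\<^bsub>G\<^esub> N" "D \<in> rcosets\<^bsub>G\<^esub> N" and x: "x \<in> EN"
    then obtain g h where "g \<in> carrier G" "C = N #>\<^bsub>G\<^esub> g" "h \<in> carrier G" "D = N #>\<^bsub>G\<^esub> h"
      by (auto simp: RCOSETS_def)
    then show "?act (C <#>\<^bsub>G\<^esub> D) x = ?act C (?act D x)"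
      using x by (simp only: N.rcos_sum G.m_closed act_coset act_act stable EN)
  qed
qed

lemma (in topological_module) auto_action: "auto_action G A act"
proof -
  interpret h: group_hom G "AutoGroup A" act
    by (intro group_hom.intro group_hom_axioms.intro G.is_group A.AutoGroup act_hom)
  have aut: "act g \<in> auto A" if "g \<in> carrier G" for g
    using h.hom_closed [OF that] by (simp add: AutoGroup_def)
  have Bij: "act g \<in> Bij (carrier A)" if "g \<in> carrier G" for g
    using aut [OF that] by (simp add: auto_def)
  show ?thesis
  proof unfold_locales
    fix g x assume "g \<in> carrier G" "x \<in> carrier A"
    then show "act g x \<in> carrier A" using aut by (auto simp: auto_def hom_def)
  next
    fix g x y assume "g \<in> carrier G" "x \<in> carrier A" "y \<in> carrier A"
    then show "act g (x \<otimes>\<^bsub>A\<^esub> y) = act g x \<otimes>\<^bsub>A\<^esub> act g y"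
      using aut by (auto simp: auto_def hom_def)
  next
    fix x assume "x \<in> carrier A"
    then show "act \<one>\<^bsub>G\<^esub> x = x"
      using h.hom_one by (simp add: AutoGroup_def BijGroup_def)
  next
    fix g h x assume "g \<in> carrier G" "h \<in> carrier G" "x \<in> carrier A"
    then show "act (g \<otimes>\<^bsub>G\<^esub> h) x = act g (act h x)"
      \<comment> \<open>The product of \<open>BijGroup\<close> is itself restricted to bijections,
        so it unfolds to composition only when \<open>Bij\<close> is supplied.\<close>
      using h.hom_mult [of g h] Bij by (simp add: AutoGroup_def BijGroup_def compose_def)
  qed
qed

section \<open>The cohomology relation\<close>

context group
begin

lemma mult_inv_cancel: "\<lbrakk>x \<in> carrier G; y \<in> carrier G\<rbrakk> \<Longrightarrow> x \<otimes> (inv x \<otimes> y) = y"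
  by (simp add: m_assoc [symmetric])

lemma inv_mult_cancel: "\<lbrakk>x \<in> carrier G; y \<in> carrier G\<rbrakk> \<Longrightarrow> inv x \<otimes> (x \<otimes> y) = y"
  by (simp add: m_assoc [symmetric])

text \<open>Rewriting with these brackets words to the right and cancels neighbouring inverses,
  which settles the identities between twisted cocycles below.\<close>

lemmas word_simps = m_assoc inv_mult_group mult_inv_cancel inv_mult_cancel

end

text \<open>Evaluates a map given by a formula on representatives at one chosen representative:
  constancy on the class makes the image a singleton.\<close>

lemma the_elem_image_class:
  assumes "equiv X r" "x \<in> X" "\<And>y. (x, y) \<in> r \<Longrightarrow> f y = f x"
  shows "the_elem (f ` (r `` {x})) = f x"
proof -
  have "f ` (r `` {x}) = {f x}"
    using assms(3) equiv_class_self [OF assms(1,2)] by blast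
  then show ?thesis by simp
qed

text \<open>Isolates the structure entering the definition of \<open>H1\<close>, so that the
  calculus of classes is developed once and then instantiated for \<open>G\<close>, for
  \<open>G/N\<close> and for \<open>N\<close>.\<close>

locale equivariant_bimodule =
  GR: auto_action G "base_grp M" "act_GR M" + GA: auto_action G "mod_grp M" "act_GA M"
  for G :: "'g topgroup" and M :: "('g, 'r, 'a) bimodule" +
  assumes bmap_hom: "bmap M \<in> hom (mod_grp M) (base_grp M)"
    and bmap_act: "\<lbrakk>g \<in> carrier G; a \<in> carrier (mod_grp M)\<rbrakk> \<Longrightarrow>
      bmap M (act_GA M g a) = act_GR M g (bmap M a)"
    and topspace_G: "topspace (topo G) = carrier G"
    and topspace_A: "topspace (topo (mod_grp M)) = carrier (mod_grp M)"
begin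

sublocale bm: group_hom "mod_grp M" "base_grp M" "bmap M"
  using bmap_hom by unfold_locales

abbreviation "R \<equiv> base_grp M"
abbreviation "A \<equiv> mod_grp M"
abbreviation "\<mu> \<equiv> bmap M"
abbreviation "gr \<equiv> act_GR M"
abbreviation "ga \<equiv> act_GA M"

text \<open>The twisting element is a parameter because later arguments invert it, multiply it and
  show that it is fixed by \<open>N\<close>.\<close>

definition cohomologous_via :: "'a \<Rightarrow> ('g \<Rightarrow> 'a) \<Rightarrow> ('g \<Rightarrow> 'a) \<Rightarrow> bool" where
  "cohomologous_via a \<alpha> \<beta> \<longleftrightarrow> a \<in> carrier A \<and>
     (\<forall>g\<in>carrier G. \<beta> g = inv\<^bsub>A\<^esub> a \<otimes>\<^bsub>A\<^esub> \<alpha> g \<otimes>\<^bsub>A\<^esub> ga g a)"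

lemma Der_cD:
  assumes "(\<alpha>, r) \<in> Der_c G M"
  shows "\<alpha> \<in> extensional (carrier G)" "continuous_map (topo G) (topo A) \<alpha>"
    "\<And>g. g \<in> carrier G \<Longrightarrow> \<alpha> g \<in> carrier A"
    "\<And>g h. \<lbrakk>g \<in> carrier G; h \<in> carrier G\<rbrakk> \<Longrightarrow> \<alpha> (g \<otimes>\<^bsub>G\<^esub> h) = \<alpha> g \<otimes>\<^bsub>A\<^esub> ga g (\<alpha> h)"
    "r \<in> carrier R"
    "\<And>g. g \<in> carrier G \<Longrightarrow> \<mu> (\<alpha> g) = r \<otimes>\<^bsub>R\<^esub> gr g (inv\<^bsub>R\<^esub> r)"
  using assms topspace_G topspace_A by (auto simp: Der_c_def continuous_map_def Pi_iff)

lemma Der_c_one: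
  assumes "(\<alpha>, r) \<in> Der_c G M"
  shows "\<alpha> \<one>\<^bsub>G\<^esub> = \<one>\<^bsub>A\<^esub>"
proof -
  have "\<alpha> \<one>\<^bsub>G\<^esub> \<otimes>\<^bsub>A\<^esub> \<alpha> \<one>\<^bsub>G\<^esub> = \<alpha> \<one>\<^bsub>G\<^esub>"
    using Der_cD(3) [OF assms, of "\<one>\<^bsub>G\<^esub>"] Der_cD(4) [OF assms, of "\<one>\<^bsub>G\<^esub>" "\<one>\<^bsub>G\<^esub>"] by simp
  then show ?thesis using Der_cD(3) [OF assms] by simp
qed

lemma trivial_in_Der_c: "(\<lambda>g\<in>carrier G. \<one>\<^bsub>A\<^esub>, \<one>\<^bsub>R\<^esub>) \<in> Der_c G M"
proof -
  have "continuous_map (topo G) (topo A) (\<lambda>g\<in>carrier G. \<one>\<^bsub>A\<^esub>)"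
    by (rule continuous_map_eq [of _ _ "\<lambda>g. \<one>\<^bsub>A\<^esub>"]) (auto simp: topspace_G topspace_A)
  then show ?thesis by (simp add: Der_c_def)
qed

lemma cohomologous_via_refl:
  assumes "(\<alpha>, r) \<in> Der_c G M"
  shows "cohomologous_via \<one>\<^bsub>A\<^esub> \<alpha> \<alpha>"
  using Der_cD(3) [OF assms] by (simp add: cohomologous_via_def)

lemma cohomologous_via_sym:
  assumes "(\<alpha>, r) \<in> Der_c G M" "cohomologous_via a \<alpha> \<beta>"
  shows "cohomologous_via (inv\<^bsub>A\<^esub> a) \<beta> \<alpha>"
  using Der_cD(3) [OF assms(1)] assms(2)
  by (simp add: cohomologous_via_def GA.act_inv GA.E.word_simps)

lemma cohomologous_via_trans:
  assumes "(\<alpha>, r) \<in> Der_c G M" "cohomologous_via a \<alpha> \<beta>" "cohomologous_via b \<beta> \<gamma>"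
  shows "cohomologous_via (a \<otimes>\<^bsub>A\<^esub> b) \<alpha> \<gamma>"
  using Der_cD(3) [OF assms(1)] assms(2,3)
  by (simp add: cohomologous_via_def GA.act_mult GA.E.word_simps)

text \<open>The membership in \<open>\<mu>(a)\<^sup>-\<^sup>1 r H\<^sup>0(G, R)\<close> comes for free: \<open>\<mu>(\<beta>(g))\<close> determines \<open>s\<close> up to a
  right factor fixed by \<open>G\<close>.\<close>

lemma Der_rel_iff:
  "((\<alpha>, r), (\<beta>, s)) \<in> Der_rel G M \<longleftrightarrow>
     (\<alpha>, r) \<in> Der_c G M \<and> (\<beta>, s) \<in> Der_c G M \<and> (\<exists>a. cohomologous_via a \<alpha> \<beta>)"
proof -
  have "s \<in> (inv\<^bsub>R\<^esub> (\<mu> a) \<otimes>\<^bsub>R\<^esub> r) <#\<^bsub>R\<^esub> H0 G M"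
    if \<alpha>: "(\<alpha>, r) \<in> Der_c G M" and \<beta>: "(\<beta>, s) \<in> Der_c G M" and a: "cohomologous_via a \<alpha> \<beta>" for a
  proof -
    note [simp] = Der_cD(3,5) [OF \<alpha>] Der_cD(3,5) [OF \<beta>]
    have [simp]: "a \<in> carrier A" using a by (simp add: cohomologous_via_def)
    \<comment> \<open>\<open>t\<close> is the expected value of \<open>s\<close>; it remains to see
      that \<open>t^-1 s\<close> is fixed by \<open>G\<close>.\<close>
    define t where "t = inv\<^bsub>R\<^esub> (\<mu> a) \<otimes>\<^bsub>R\<^esub> r"
    have [simp]: "t \<in> carrier R" by (simp add: t_def)
    have "gr g (inv\<^bsub>R\<^esub> t \<otimes>\<^bsub>R\<^esub> s) = inv\<^bsub>R\<^esub> t \<otimes>\<^bsub>R\<^esub> s" if [simp]: "g \<in> carrier G" for g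
    proof -
      have "s \<otimes>\<^bsub>R\<^esub> inv\<^bsub>R\<^esub> (gr g s) = \<mu> (\<beta> g)"
        using Der_cD(6) [OF \<beta>, of g] by (simp add: GR.act_inv)
      also have "\<dots> = inv\<^bsub>R\<^esub> (\<mu> a) \<otimes>\<^bsub>R\<^esub> (r \<otimes>\<^bsub>R\<^esub> gr g (inv\<^bsub>R\<^esub> r)) \<otimes>\<^bsub>R\<^esub> gr g (\<mu> a)"
        using a Der_cD(6) [OF \<alpha>, of g] by (simp add: cohomologous_via_def bmap_act)
      also have "\<dots> = t \<otimes>\<^bsub>R\<^esub> inv\<^bsub>R\<^esub> (gr g t)"
        by (simp add: t_def GR.act_mult GR.act_inv GR.E.word_simps)
      \<comment> \<open>From \<open>s (gs)^-1 = t (gt)^-1\<close>, multiplying by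
        \<open>t^-1\<close> on the left and by \<open>gs\<close> on the right gives
        \<open>t^-1 s = (gt)^-1 (gs)\<close>.\<close>
      finally have "inv\<^bsub>R\<^esub> t \<otimes>\<^bsub>R\<^esub> (s \<otimes>\<^bsub>R\<^esub> inv\<^bsub>R\<^esub> (gr g s)) \<otimes>\<^bsub>R\<^esub> gr g s =
          inv\<^bsub>R\<^esub> t \<otimes>\<^bsub>R\<^esub> (t \<otimes>\<^bsub>R\<^esub> inv\<^bsub>R\<^esub> (gr g t)) \<otimes>\<^bsub>R\<^esub> gr g s" by simp
      then have "inv\<^bsub>R\<^esub> t \<otimes>\<^bsub>R\<^esub> s = inv\<^bsub>R\<^esub> (gr g t) \<otimes>\<^bsub>R\<^esub> gr g s"
        by (simp add: GR.E.word_simps)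
      also have "\<dots> = gr g (inv\<^bsub>R\<^esub> t \<otimes>\<^bsub>R\<^esub> s)" by (simp add: GR.act_mult GR.act_inv)
      finally show ?thesis ..
    qed
    then have "inv\<^bsub>R\<^esub> t \<otimes>\<^bsub>R\<^esub> s \<in> H0 G M"
      by (simp add: H0_def fixed_points_def)
    moreover have "s = t \<otimes>\<^bsub>R\<^esub> (inv\<^bsub>R\<^esub> t \<otimes>\<^bsub>R\<^esub> s)"
      by (simp add: GR.E.mult_inv_cancel)
    ultimately show ?thesis by (auto simp: l_coset_def t_def)
  qed
  then show ?thesis
    by (auto simp: Der_rel_def cohomologous_via_def)
qed

text \<open>The twisting elements are the unit, the inverse and the product, respectively.\<close>

lemma equiv_Der_rel: "equiv (Der_c G M) (Der_rel G M)"
proof (rule equivI)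
  show "Der_rel G M \<subseteq> Der_c G M \<times> Der_c G M" by (auto simp: Der_rel_def)
  show "refl_on (Der_c G M) (Der_rel G M)"
  proof (rule refl_onI, clarify)
    fix \<alpha> r assume "(\<alpha>, r) \<in> Der_c G M"
    then show "((\<alpha>, r), \<alpha>, r) \<in> Der_rel G M"
      using cohomologous_via_refl  unfolding Der_rel_iff by blast
  qed
  show "sym (Der_rel G M)"
  proof (rule symI, clarify)
    fix \<alpha> r \<beta> s assume "((\<alpha>, r), \<beta>, s) \<in> Der_rel G M"
    then show "((\<beta>, s), \<alpha>, r) \<in> Der_rel G M"
      using cohomologous_via_sym  unfolding Der_rel_iff by blast
  qed
  show "trans (Der_rel G M)"
  proof (rule transI, clarify)
    fix \<alpha> r \<beta> s \<gamma> t assume "((\<alpha>, r), \<beta>, s) \<in> Der_rel G M" "((\<beta>, s), \<gamma>, t) \<in> Der_rel G M"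
    then show "((\<alpha>, r), \<gamma>, t) \<in> Der_rel G M"
      using cohomologous_via_trans  unfolding Der_rel_iff by blast
  qed
qed

text \<open>By \<open>Der_rel_iff\<close>, comparing classes of valid pairs amounts to finding a
  twisting element; the second components drop out.\<close>

lemma H1_class_eq_iff:
  assumes "(\<alpha>, r) \<in> Der_c G M" "(\<beta>, s) \<in> Der_c G M"
  shows "H1_class G M (\<alpha>, r) = H1_class G M (\<beta>, s) \<longleftrightarrow> (\<exists>a. cohomologous_via a \<alpha> \<beta>)"
  using eq_equiv_class_iff [OF equiv_Der_rel assms] assms by (simp add: H1_class_def Der_rel_iff)

lemma H1_class_in_H1: "x \<in> Der_c G M \<Longrightarrow> H1_class G M x \<in> H1 G M"
  by (simp add: H1_class_def H1_def quotientI)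

lemma H1_cases:
  assumes "c \<in> H1 G M"
  obtains \<alpha> r where "(\<alpha>, r) \<in> Der_c G M" "c = H1_class G M (\<alpha>, r)"
  using assms by (auto simp: H1_def H1_class_def elim!: quotientE)

lemma H1_base_in_H1: "H1_base G M \<in> H1 G M"
  unfolding H1_base_def by (intro H1_class_in_H1 trivial_in_Der_c)

text \<open>In the product of \<beta>(g) with the g-translate of \<beta>(h), the translates of
  \<open>a\<close> and \<open>a^-1\<close> cancel, so a twist of a crossed homomorphism is again
  one. Continuity is a premise, since this locale carries no topology on the actions.\<close>

lemma Der_c_transfer:
  assumes \<alpha>: "(\<alpha>, r) \<in> Der_c G M" and a: "cohomologous_via a \<alpha> \<beta>"
    and \<beta>: "\<beta> \<in> extensional (carrier G)" "continuous_map (topo G) (topo A) \<beta>"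
    and s: "s \<in> carrier R" "\<And>g. g \<in> carrier G \<Longrightarrow> \<mu> (\<beta> g) = s \<otimes>\<^bsub>R\<^esub> gr g (inv\<^bsub>R\<^esub> s)"
  shows "(\<beta>, s) \<in> Der_c G M"
proof -
  have "\<beta> (g \<otimes>\<^bsub>G\<^esub> h) = \<beta> g \<otimes>\<^bsub>A\<^esub> ga g (\<beta> h)"
    if "g \<in> carrier G" "h \<in> carrier G" for g h
    using a that Der_cD(3) [OF \<alpha>]
    by (simp add: cohomologous_via_def Der_cD(4) [OF \<alpha>] GA.act_mult GA.act_inv GA.act_act
        GA.E.word_simps)
  then show ?thesis using \<beta> s by (simp add: Der_c_def)
qed

end

section \<open>Continuity of twisted maps\<close>

lemma (in topological_group) continuous_map_mult:
  assumes "continuous_map X (topo G) f" "continuous_map X (topo G) h"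
  shows "continuous_map X (topo G) (\<lambda>x. f x \<otimes> h x)"
proof -
  have "continuous_map X (prod_topology (topo G) (topo G)) (\<lambda>x. (f x, h x))"
    using assms by (simp add: continuous_map_pairedI)
  from continuous_map_compose [OF this continuous_mult] show ?thesis
    by (simp add: o_def)
qed

lemma (in topological_module) continuous_map_act:
  assumes "continuous_map X (topo G) f" "continuous_map X (topo A) h"
  shows "continuous_map X (topo A) (\<lambda>x. act (f x) (h x))"
proof -
  have "continuous_map X (prod_topology (topo G) (topo A)) (\<lambda>x. (f x, h x))"
    using assms by (simp add: continuous_map_pairedI)
  from continuous_map_compose [OF this act_continuous] show ?thesis
    by (simp add: o_def)
qed

text \<open>The source \<open>X\<close> and the map \<open>f\<close> are arbitrary so that the fact
  covers twisting on \<open>G\<close> and on the subspace \<open>N\<close>.\<close>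

lemma (in topological_module) continuous_map_twist:
  assumes "continuous_map X (topo G) f" "continuous_map X (topo A) \<alpha>" "a \<in> carrier A"
  shows "continuous_map X (topo A) (\<lambda>x. inv\<^bsub>A\<^esub> a \<otimes>\<^bsub>A\<^esub> \<alpha> x \<otimes>\<^bsub>A\<^esub> act (f x) a)"
  using assms by (intro A.continuous_map_mult continuous_map_act) (simp_all add: A.topspace_eq)

section \<open>Inflation and restriction\<close>

lemma (in partially_crossed_bimodule) equivariant_bimodule: "equivariant_bimodule G M"
  using bmap_equivariant GR.G.topspace_eq A.topspace_eq mu_hom
  by (intro equivariant_bimodule.intro GR.auto_action GA.auto_action)
    (simp_all add: equivariant_bimodule_axioms_def)

locale normal_bimodule =
  E: equivariant_bimodule G M + partially_crossed_bimodule G M + N: normal N G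
  for G :: "'g topgroup" and M :: "('g, 'r, 'a) bimodule" and N :: "'g set"
begin

abbreviation "R \<equiv> base_grp M"
abbreviation "A \<equiv> mod_grp M"
abbreviation "\<mu> \<equiv> bmap M"
abbreviation "gr \<equiv> act_GR M"
abbreviation "ga \<equiv> act_GA M"
abbreviation "RN \<equiv> fixed_points N gr (carrier R)"
abbreviation "AN \<equiv> fixed_points N ga (carrier A)"
abbreviation "S \<equiv> sub_topgroup G N"
abbreviation "Q \<equiv> quot_topgroup G N"
abbreviation "F \<equiv> fixed_bimodule N M"

section \<open>Coset representatives and the bimodules over \<open>G/N\<close> and
  \<open>N\<close>\<close>

lemma normal: "N \<lhd> G" by (rule N.normal_axioms)

lemma fixed_bimodule_simps [simp]:
  "base_grp F = sub_topgroup R RN" "mod_grp F = sub_topgroup A AN"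
  "bmap F = restrict \<mu> AN"
  "act_GR F = (\<lambda>C. \<lambda>x\<in>RN. the_elem ((\<lambda>g. gr g x) ` C))"
  "act_GA F = (\<lambda>C. \<lambda>x\<in>AN. the_elem ((\<lambda>g. ga g x) ` C))"
  by (simp_all add: fixed_bimodule_def Let_def)

lemma subgroup_RN: "subgroup RN R" and subgroup_AN: "subgroup AN A"
  by (rule E.GR.subgroup_fixed_points E.GA.subgroup_fixed_points, rule N.subset)+

lemma AN_carrier: "a \<in> AN \<Longrightarrow> a \<in> carrier A" and RN_carrier: "r \<in> RN \<Longrightarrow> r \<in> carrier R"
  by (simp_all add: fixed_points_def)

lemma mu_AN: "a \<in> AN \<Longrightarrow> \<mu> a \<in> RN"
  using E.bmap_act [symmetric] by (auto simp: fixed_points_def)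

lemma act_coset_GR:
  "\<lbrakk>g \<in> carrier G; r \<in> RN\<rbrakk> \<Longrightarrow> act_GR F (N #>\<^bsub>G\<^esub> g) r = gr g r"
  by (simp add: E.GR.coset_act_fixed_points [OF normal])

lemma act_coset_GA:
  "\<lbrakk>g \<in> carrier G; a \<in> AN\<rbrakk> \<Longrightarrow> act_GA F (N #>\<^bsub>G\<^esub> g) a = ga g a"
  by (simp add: E.GA.coset_act_fixed_points [OF normal])

lemma quotient_cases:
  assumes "C \<in> carrier Q"
  obtains g where "g \<in> carrier G" "C = N #>\<^bsub>G\<^esub> g"
  using assms by (auto simp: RCOSETS_def)

lemma coset_in_Q: "g \<in> carrier G \<Longrightarrow> N #>\<^bsub>G\<^esub> g \<in> carrier Q"
  by (auto simp: RCOSETS_def)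

lemma quotient_map_coset: "quotient_map (topo G) (topo Q) (\<lambda>g. N #>\<^bsub>G\<^esub> g)"
  by (simp add: quotient_map_quotient_topology)

sublocale Q: equivariant_bimodule Q F
proof (intro equivariant_bimodule.intro equivariant_bimodule_axioms.intro)
  show "auto_action Q (base_grp F) (act_GR F)" "auto_action Q (mod_grp F) (act_GA F)"
    unfolding fixed_bimodule_simps
    by (rule auto_action_quotient [OF _ normal] E.GR.auto_action_axioms E.GA.auto_action_axioms)+
  show "bmap F \<in> hom (mod_grp F) (base_grp F)"
    using mu_AN subgroup.m_closed [OF subgroup_AN]
    by (auto simp: hom_def AN_carrier)
  show "bmap F (act_GA F C a) = act_GR F C (bmap F a)"
    if C: "C \<in> carrier Q" and "a \<in> carrier (mod_grp F)" for C a
  proof -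
    obtain g where g: "g \<in> carrier G" "C = N #>\<^bsub>G\<^esub> g" using C by (rule quotient_cases)
    have a: "a \<in> AN" using that by simp
    have "ga g a \<in> AN" using E.GA.fixed_points_stable [OF normal g(1) a] .
    then have "bmap F (act_GA F C a) = \<mu> (ga g a)"
      unfolding g(2) act_coset_GA [OF g(1) a] by simp
    moreover have "act_GR F C (bmap F a) = gr g (\<mu> a)"
      unfolding g(2) using act_coset_GR [OF g(1) mu_AN [OF a]] a by simp
    ultimately show ?thesis by (simp add: E.bmap_act g AN_carrier [OF a])
  qed
  have "carrier Q = (\<lambda>g. N #>\<^bsub>G\<^esub> g) ` topspace (topo G)"
    by (auto simp: RCOSETS_def E.topspace_G)
  then show "topspace (topo Q) = carrier Q"
    using quotient_imp_surjective_map [OF quotient_map_coset] by simp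
  show "topspace (topo (mod_grp F)) = carrier (mod_grp F)"
    by (auto simp: E.topspace_A AN_carrier)
qed

sublocale S: equivariant_bimodule S M
proof (intro equivariant_bimodule.intro equivariant_bimodule_axioms.intro)
  show "auto_action S R gr" "auto_action S A ga"
    by (rule auto_action_restrict N.subgroup_axioms E.GR.auto_action_axioms
        E.GA.auto_action_axioms)+
qed (auto simp: E.bmap_hom E.bmap_act E.topspace_G E.topspace_A)

section \<open>Inflation\<close>

abbreviation infl :: "('g set \<Rightarrow> 'a) \<Rightarrow> 'g \<Rightarrow> 'a" where
  "infl \<alpha> \<equiv> compose (carrier G) \<alpha> (\<lambda>g. N #>\<^bsub>G\<^esub> g)"

text \<open>Continuity transfers by the universal property of the quotient map, and the equations
  transfer because cosets may be replaced by representatives. Both directions matter: one inflates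
  cocycles, the other lets them descend.\<close>

lemma Der_c_infl_iff:
  assumes "\<alpha> \<in> extensional (carrier Q)" "\<And>C. C \<in> carrier Q \<Longrightarrow> \<alpha> C \<in> AN" "r \<in> RN"
  shows "(infl \<alpha>, r) \<in> Der_c G M \<longleftrightarrow> (\<alpha>, r) \<in> Der_c Q F"
proof -
  have "continuous_map (topo G) (topo A) (infl \<alpha>) \<longleftrightarrow>
      continuous_map (topo G) (topo A) (\<alpha> \<circ> (\<lambda>g. N #>\<^bsub>G\<^esub> g))"
    by (auto simp: compose_def E.topspace_G intro: continuous_map_eq)
  also have "\<dots> \<longleftrightarrow> continuous_map (topo Q) (topo A) \<alpha>"
    by (rule continuous_compose_quotient_map_eq [OF quotient_map_coset])
  also have "\<dots> \<longleftrightarrow> continuous_map (topo Q) (topo (mod_grp F)) \<alpha>"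
    using assms(2) Q.topspace_G by (auto simp: continuous_map_in_subtopology)
  finally have cont: "continuous_map (topo G) (topo A) (infl \<alpha>) \<longleftrightarrow>
    continuous_map (topo Q) (topo (mod_grp F)) \<alpha>" .
  have all_Q: "(\<forall>C\<in>carrier Q. P C) \<longleftrightarrow> (\<forall>g\<in>carrier G. P (N #>\<^bsub>G\<^esub> g))" for P
    using coset_in_Q by (metis quotient_cases)
  have AN: "\<alpha> (N #>\<^bsub>G\<^esub> g) \<in> AN" if "g \<in> carrier G" for g
    using assms(2) coset_in_Q [OF that] by blast
  have mult: "(\<forall>C\<in>carrier Q. \<forall>D\<in>carrier Q.
        \<alpha> (C \<otimes>\<^bsub>Q\<^esub> D) = \<alpha> C \<otimes>\<^bsub>mod_grp F\<^esub> act_GA F C (\<alpha> D)) \<longleftrightarrow>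
      (\<forall>g\<in>carrier G. \<forall>h\<in>carrier G. infl \<alpha> (g \<otimes>\<^bsub>G\<^esub> h) = infl \<alpha> g \<otimes>\<^bsub>A\<^esub> ga g (infl \<alpha> h))"
    unfolding all_Q
    \<comment> \<open>The coset action must stay folded for \<open>act_coset_GA\<close> to apply,
      hence the deleted rule.\<close>
    by (intro ball_cong refl)
      (simp add: act_coset_GA AN compose_def N.rcos_sum del: fixed_bimodule_simps(5))
  have inv_RN: "inv\<^bsub>R\<^esub> r \<in> RN" by (rule subgroup.m_inv_closed [OF subgroup_RN assms(3)])
  have bmap: "(\<forall>C\<in>carrier Q. bmap F (\<alpha> C) =
        r \<otimes>\<^bsub>base_grp F\<^esub> act_GR F C (inv\<^bsub>base_grp F\<^esub> r)) \<longleftrightarrow>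
      (\<forall>g\<in>carrier G. \<mu> (infl \<alpha> g) = r \<otimes>\<^bsub>R\<^esub> gr g (inv\<^bsub>R\<^esub> r))"
    unfolding all_Q
    by (intro ball_cong refl)
      (simp add: act_coset_GR inv_RN AN assms(3) compose_def
        inv_sub_topgroup [OF E.GR.E.is_group subgroup_RN] del: fixed_bimodule_simps(4))
  show ?thesis
    unfolding Der_c_def using cont mult bmap assms(1,3) RN_carrier [OF assms(3)]
    by simp
qed

lemma infl_in_Der_c:
  assumes "(\<alpha>, r) \<in> Der_c Q F"
  shows "(infl \<alpha>, r) \<in> Der_c G M"
  using assms Q.Der_cD(1,3,5) [OF assms] by (subst Der_c_infl_iff) simp_all

text \<open>Both inflations are trivial on \<open>N\<close>, so a twisting element satisfies
  \<open>a^-1 (na) = 1\<close> for \<open>n\<close> in \<open>N\<close> and thus lies in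
  \<open>AN\<close>. One direction makes inflation well defined, the other makes it
  injective.\<close>

lemma cohomologous_infl_iff:
  assumes \<alpha>: "(\<alpha>, r) \<in> Der_c Q F" and \<beta>: "(\<beta>, s) \<in> Der_c Q F"
  shows "E.cohomologous_via a (infl \<alpha>) (infl \<beta>) \<longleftrightarrow> Q.cohomologous_via a \<alpha> \<beta>"
proof -
  have coset: "N #>\<^bsub>G\<^esub> n = \<one>\<^bsub>Q\<^esub>" if "n \<in> N" for n
    using E.GR.G.coset_join2 [OF _ N.subgroup_axioms that] that by simp
  have "a \<in> AN" if a: "E.cohomologous_via a (infl \<alpha>) (infl \<beta>)"
  proof -
    have aA: "a \<in> carrier A" using a by (simp add: E.cohomologous_via_def)
    have "ga n a = a" if n: "n \<in> N" for n
    proof -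
      have "infl \<alpha> n = \<one>\<^bsub>A\<^esub>" "infl \<beta> n = \<one>\<^bsub>A\<^esub>"
        using n coset Q.Der_c_one [OF \<alpha>] Q.Der_c_one [OF \<beta>] by (simp_all add: compose_def)
      then have "inv\<^bsub>A\<^esub> a \<otimes>\<^bsub>A\<^esub> ga n a = \<one>\<^bsub>A\<^esub>"
        using a aA n by (simp add: E.cohomologous_via_def)
      then have "a \<otimes>\<^bsub>A\<^esub> (inv\<^bsub>A\<^esub> a \<otimes>\<^bsub>A\<^esub> ga n a) = a" using aA by simp
      then show ?thesis using aA n by (simp add: E.GA.E.mult_inv_cancel)
    qed
    then show ?thesis using aA by (simp add: fixed_points_def)
  qed
  moreover have "E.cohomologous_via a (infl \<alpha>) (infl \<beta>) \<longleftrightarrow> Q.cohomologous_via a \<alpha> \<beta>"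
    if a: "a \<in> AN"
  proof -
    have "(\<forall>C\<in>carrier Q. P C) \<longleftrightarrow> (\<forall>g\<in>carrier G. P (N #>\<^bsub>G\<^esub> g))" for P
      using coset_in_Q by (metis quotient_cases)
    then show ?thesis
      unfolding E.cohomologous_via_def Q.cohomologous_via_def
      using a AN_carrier [OF a] inv_sub_topgroup [OF E.GA.E.is_group subgroup_AN a]
      by (simp add: act_coset_GA compose_def del: fixed_bimodule_simps(5))
  qed
  ultimately show ?thesis
    unfolding Q.cohomologous_via_def by auto
qed

lemma Inf1_class:
  assumes "(\<alpha>, r) \<in> Der_c Q F"
  shows "Inf1 G N M (H1_class Q F (\<alpha>, r)) = H1_class G M (infl \<alpha>, r)"
  unfolding Inf1_def H1_class_def [of Q]
proof (subst the_elem_image_class [OF Q.equiv_Der_rel assms]; clarsimp)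
  fix \<beta> s assume "((\<alpha>, r), \<beta>, s) \<in> Der_rel Q F"
  then show "H1_class G M (infl \<beta>, s) = H1_class G M (infl \<alpha>, r)"
    unfolding Q.Der_rel_iff using cohomologous_infl_iff infl_in_Der_c E.H1_class_eq_iff by metis
qed

lemma inj_on_Inf1: "inj_on (Inf1 G N M) (H1 Q F)"
proof (rule inj_onI)
  fix c d assume "c \<in> H1 Q F" "d \<in> H1 Q F" and eq: "Inf1 G N M c = Inf1 G N M d"
  then obtain \<alpha> r \<beta> s where
    \<alpha>: "(\<alpha>, r) \<in> Der_c Q F" "c = H1_class Q F (\<alpha>, r)" and
    \<beta>: "(\<beta>, s) \<in> Der_c Q F" "d = H1_class Q F (\<beta>, s)"
    by (metis Q.H1_cases)
  have "\<exists>a. E.cohomologous_via a (infl \<alpha>) (infl \<beta>)"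
    using eq by (simp add: \<alpha> \<beta> Inf1_class E.H1_class_eq_iff infl_in_Der_c)
  then show "c = d"
    by (simp add: \<alpha> \<beta> Q.H1_class_eq_iff cohomologous_infl_iff [OF \<alpha>(1) \<beta>(1)])
qed

lemma Inf1_base: "Inf1 G N M (H1_base Q F) = H1_base G M"
proof -
  have "infl (\<lambda>C\<in>carrier Q. \<one>\<^bsub>mod_grp F\<^esub>) = (\<lambda>g\<in>carrier G. \<one>\<^bsub>A\<^esub>)"
    using coset_in_Q by (auto simp: compose_def)
  then show ?thesis
    unfolding H1_base_def using Inf1_class [OF Q.trivial_in_Der_c] by simp
qed

section \<open>Restriction and invariance under \<open>G/N\<close>\<close>

lemma Der_c_restrict:
  assumes "(\<alpha>, r) \<in> Der_c G M"
  shows "(restrict \<alpha> N, r) \<in> Der_c S M"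
proof -
  have "continuous_map (subtopology (topo G) N) (topo A) (restrict \<alpha> N)"
    using E.Der_cD(2) [OF assms]
    by (intro continuous_map_eq [OF continuous_map_from_subtopology]) auto
  then show ?thesis
    using E.Der_cD(4,5,6) [OF assms] by (simp add: Der_c_def)
qed

text \<open>A twisting element over \<open>G\<close> serves unchanged over \<open>N\<close>.\<close>

lemma Res1_class:
  assumes "(\<alpha>, r) \<in> Der_c G M"
  shows "Res1 G N M (H1_class G M (\<alpha>, r)) = H1_class S M (restrict \<alpha> N, r)"
  unfolding Res1_def H1_class_def [of G]
proof (subst the_elem_image_class [OF E.equiv_Der_rel assms]; clarsimp)
  fix \<beta> s assume "((\<alpha>, r), \<beta>, s) \<in> Der_rel G M"
  then obtain a where "(\<beta>, s) \<in> Der_c G M" and a: "E.cohomologous_via a \<alpha> \<beta>"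
    by (auto simp: E.Der_rel_iff)
  moreover have "S.cohomologous_via a (restrict \<alpha> N) (restrict \<beta> N)"
    using a by (simp add: E.cohomologous_via_def S.cohomologous_via_def)
  ultimately show "H1_class S M (restrict \<beta> N, s) = H1_class S M (restrict \<alpha> N, r)"
    using Der_c_restrict assms S.H1_class_eq_iff by metis
qed

lemma Res1_base: "Res1 G N M (H1_base G M) = H1_base S M"
proof -
  have "restrict (\<lambda>g\<in>carrier G. \<one>\<^bsub>A\<^esub>) N = (\<lambda>g\<in>carrier S. \<one>\<^bsub>A\<^esub>)" by auto
  then show ?thesis
    unfolding H1_base_def using Res1_class [OF E.trivial_in_Der_c] by simp
qed

text \<open>If \<open>a\<close> twists \<open>\<alpha>|N\<close> into \<open>\<beta>\<close>, then \<open>\<alpha>(g) \<cdot> \<^sup>ga\<close> twists it into the conjugate of \<open>\<beta>\<close> by \<open>g\<close>: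
  expand \<open>\<alpha>(gm) = \<alpha>(ng)\<close> for \<open>m = g\<^sup>-\<^sup>1ng\<close>.\<close>

lemma H1_act_Res1:
  assumes \<alpha>: "(\<alpha>, r) \<in> Der_c G M" and C: "C \<in> carrier Q"
  shows "H1_act G N M C (H1_class S M (restrict \<alpha> N, r)) = H1_class S M (restrict \<alpha> N, r)"
proof -
  let ?tw = "\<lambda>g \<beta>. \<lambda>n\<in>N. ga g (\<beta> (inv\<^bsub>G\<^esub> g \<otimes>\<^bsub>G\<^esub> n \<otimes>\<^bsub>G\<^esub> g))"
  note \<alpha>S = Der_c_restrict [OF \<alpha>]
  \<comment> \<open>\<open>H1_act\<close> ranges over all elements of the coset and all pairs in the
    class, so the claim is needed for each of them.\<close>
  have *: "H1_class S M (?tw g \<beta>, gr g s) = H1_class S M (restrict \<alpha> N, r)"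
    if g: "g \<in> C" and rel: "((restrict \<alpha> N, r), (\<beta>, s)) \<in> Der_rel S M" for g \<beta> s
  proof -
    have \<beta>: "(\<beta>, s) \<in> Der_c S M" using rel by (simp add: S.Der_rel_iff)
    obtain a where a: "S.cohomologous_via a (restrict \<alpha> N) \<beta>"
      using rel by (auto simp: S.Der_rel_iff)
    then have aA [simp]: "a \<in> carrier A" by (simp add: S.cohomologous_via_def)
    have gG [simp]: "g \<in> carrier G"
      using C g N.subset by (auto simp: RCOSETS_def r_coset_def)
    have sR [simp]: "s \<in> carrier R" using S.Der_cD(5) [OF \<beta>] .
    note \<alpha>A [simp] = E.Der_cD(3) [OF \<alpha>]
    define b where "b = \<alpha> g \<otimes>\<^bsub>A\<^esub> ga g a"
    have bA [simp]: "b \<in> carrier A" by (simp add: b_def)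
    have conj: "inv\<^bsub>G\<^esub> g \<otimes>\<^bsub>G\<^esub> n \<otimes>\<^bsub>G\<^esub> g \<in> N" if "n \<in> N" for n
      using N.inv_op_closed1 [OF gG that] .
    have b: "?tw g \<beta> n = inv\<^bsub>A\<^esub> b \<otimes>\<^bsub>A\<^esub> \<alpha> n \<otimes>\<^bsub>A\<^esub> ga n b" if n: "n \<in> N" for n
    proof -
      have [simp]: "n \<in> carrier G" using n by simp
      define m where "m = inv\<^bsub>G\<^esub> g \<otimes>\<^bsub>G\<^esub> n \<otimes>\<^bsub>G\<^esub> g"
      have m [simp]: "m \<in> N" "m \<in> carrier G" using conj [OF n] by (simp_all add: m_def)
      have gm: "g \<otimes>\<^bsub>G\<^esub> m = n \<otimes>\<^bsub>G\<^esub> g" by (simp add: m_def E.GR.G.word_simps)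
      have "\<alpha> g \<otimes>\<^bsub>A\<^esub> ga g (\<alpha> m) = \<alpha> n \<otimes>\<^bsub>A\<^esub> ga n (\<alpha> g)"
        using E.Der_cD(4) [OF \<alpha>, of g m] E.Der_cD(4) [OF \<alpha>, of n g] by (simp add: gm)
      then have "inv\<^bsub>A\<^esub> (\<alpha> g) \<otimes>\<^bsub>A\<^esub> (\<alpha> g \<otimes>\<^bsub>A\<^esub> ga g (\<alpha> m)) =
          inv\<^bsub>A\<^esub> (\<alpha> g) \<otimes>\<^bsub>A\<^esub> (\<alpha> n \<otimes>\<^bsub>A\<^esub> ga n (\<alpha> g))" by simp
      \<comment> \<open>Solving for the g-translate of \<alpha>(m) shows that conjugating \<alpha>
        by \<open>g\<close> amounts to twisting it by \<alpha>(g) on \<open>N\<close>.\<close>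
      then have tw_\<alpha>: "ga g (\<alpha> m) = inv\<^bsub>A\<^esub> (\<alpha> g) \<otimes>\<^bsub>A\<^esub> (\<alpha> n \<otimes>\<^bsub>A\<^esub> ga n (\<alpha> g))"
        by (simp add: E.GA.E.word_simps)
      have "ga g (ga m a) = ga n (ga g a)"
        using E.GA.act_act [of g m a] E.GA.act_act [of n g a] by (simp add: gm)
      then have "ga g (\<beta> m) = inv\<^bsub>A\<^esub> b \<otimes>\<^bsub>A\<^esub> \<alpha> n \<otimes>\<^bsub>A\<^esub> ga n b"
        using a by (simp add: S.cohomologous_via_def b_def E.GA.act_mult E.GA.act_inv tw_\<alpha>
            E.GA.E.word_simps)
      then show ?thesis using n by (simp add: m_def)
    qed
    have via: "S.cohomologous_via b (restrict \<alpha> N) (?tw g \<beta>)"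
      using b by (simp add: S.cohomologous_via_def)
    have "(?tw g \<beta>, gr g s) \<in> Der_c S M"
    proof (rule S.Der_c_transfer [OF \<alpha>S via])
      \<comment> \<open>On \<open>N\<close> the conjugated map equals the twist of \<alpha> by
        \<open>b\<close>, so its continuity follows from that of \<alpha>.\<close>
      have "continuous_map (subtopology (topo G) N) (topo A)
          (\<lambda>n. inv\<^bsub>A\<^esub> b \<otimes>\<^bsub>A\<^esub> \<alpha> n \<otimes>\<^bsub>A\<^esub> ga n b)"
        using E.Der_cD(2) [OF \<alpha>]
        by (intro GA.continuous_map_twist continuous_map_from_subtopology) auto
      then show "continuous_map (topo S) (topo A) (?tw g \<beta>)"
        using b by (auto intro: continuous_map_eq)
      fix n assume "n \<in> carrier S"
      then have n: "n \<in> N" "n \<in> carrier G" by simp_all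
      define m where "m = inv\<^bsub>G\<^esub> g \<otimes>\<^bsub>G\<^esub> n \<otimes>\<^bsub>G\<^esub> g"
      have m [simp]: "m \<in> N" "m \<in> carrier G" using conj [OF n(1)] by (simp_all add: m_def)
      have gm: "g \<otimes>\<^bsub>G\<^esub> m = n \<otimes>\<^bsub>G\<^esub> g" using n by (simp add: m_def E.GR.G.word_simps)
      have "\<mu> (?tw g \<beta> n) = gr g (\<mu> (\<beta> m))"
        using S.Der_cD(3) [OF \<beta>, of m] n by (simp add: m_def [symmetric] E.bmap_act)
      also have "\<dots> = gr g s \<otimes>\<^bsub>R\<^esub> gr (g \<otimes>\<^bsub>G\<^esub> m) (inv\<^bsub>R\<^esub> s)"
        using S.Der_cD(6) [OF \<beta>, of m] by (simp add: E.GR.act_mult E.GR.act_act)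
      \<comment> \<open>Here \<open>gm = ng\<close> moves the action of \<open>g\<close> inside,
        onto \<open>s\<close>.\<close>
      also have "\<dots> = gr g s \<otimes>\<^bsub>R\<^esub> gr n (inv\<^bsub>R\<^esub> (gr g s))"
        using n by (simp add: gm E.GR.act_act E.GR.act_inv)
      finally show "\<mu> (?tw g \<beta> n) = gr g s \<otimes>\<^bsub>R\<^esub> gr n (inv\<^bsub>R\<^esub> (gr g s))" .
    qed simp_all
    then show ?thesis using S.H1_class_eq_iff [OF \<alpha>S] via by metis
  qed
  \<comment> \<open>Neither the coset nor the class is empty, so the image is exactly a singleton
    and \<open>the_elem\<close> returns its element.\<close>
  obtain g where "g \<in> carrier G" "C = N #>\<^bsub>G\<^esub> g" using C by (rule quotient_cases)
  then have "g \<in> C" using E.GR.G.rcos_self [OF _ N.subgroup_axioms] by simp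
  moreover have "(restrict \<alpha> N, r) \<in> H1_class S M (restrict \<alpha> N, r)"
    unfolding H1_class_def using S.equiv_Der_rel \<alpha>S by (rule equiv_class_self)
  ultimately have "(\<lambda>(g, \<beta>, s). H1_class S M (?tw g \<beta>, gr g s)) `
      (C \<times> H1_class S M (restrict \<alpha> N, r)) = {H1_class S M (restrict \<alpha> N, r)}"
    using * unfolding H1_class_def [of _ _ "(restrict \<alpha> N, r)"] by fastforce
  then show ?thesis by (simp add: H1_act_def)
qed

lemma Res1_in_H1_fixed:
  assumes "c \<in> H1 G M"
  shows "Res1 G N M c \<in> H1_fixed G N M"
proof -
  obtain \<alpha> r where \<alpha>: "(\<alpha>, r) \<in> Der_c G M" "c = H1_class G M (\<alpha>, r)"
    using assms by (rule E.H1_cases)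
  then show ?thesis
    using H1_act_Res1 [OF \<alpha>(1)] S.H1_class_in_H1 [OF Der_c_restrict [OF \<alpha>(1)]]
    by (simp add: H1_fixed_def fixed_points_def Res1_class del: quot_topgroup_simps)
qed

section \<open>The kernel of restriction\<close>

lemma Res1_Inf1:
  assumes "c \<in> H1 Q F"
  shows "Res1 G N M (Inf1 G N M c) = H1_base S M"
proof -
  obtain \<alpha> r where \<alpha>: "(\<alpha>, r) \<in> Der_c Q F" "c = H1_class Q F (\<alpha>, r)"
    using assms by (rule Q.H1_cases)
  have "restrict (infl \<alpha>) N = (\<lambda>n\<in>carrier S. \<one>\<^bsub>A\<^esub>)"
    using Q.Der_c_one [OF \<alpha>(1)] E.GR.G.coset_join2 [OF _ N.subgroup_axioms]
    by (auto simp: compose_def)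
  moreover have "(restrict (infl \<alpha>) N, r) \<in> Der_c S M"
    by (rule Der_c_restrict [OF infl_in_Der_c [OF \<alpha>(1)]])
  ultimately show ?thesis
    \<comment> \<open>The second components \<open>r\<close> and the unit may differ; the classes
      still agree, with the unit of \<open>A\<close> as twisting element.\<close>
    using S.cohomologous_via_refl S.H1_class_eq_iff S.trivial_in_Der_c
    by (metis \<alpha> H1_base_def Inf1_class Res1_class infl_in_Der_c)
qed

text \<open>The cocycle identity gives that \<beta>(ng) is the n-translate of \<beta>(g), and that
  \<beta>(gn) = \<beta>(g). Normality turns the second into \<beta>(ng) = \<beta>(g), so \<beta> is
  constant on cosets and its values are fixed by \<open>N\<close>.\<close>

lemma trivial_on_N_is_infl:
  assumes \<beta>: "(\<beta>, s) \<in> Der_c G M" and triv: "\<And>n. n \<in> N \<Longrightarrow> \<beta> n = \<one>\<^bsub>A\<^esub>"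
  obtains \<alpha> where "(\<alpha>, s) \<in> Der_c Q F" "infl \<alpha> = \<beta>"
proof -
  note [simp] = E.Der_cD(3,5) [OF \<beta>]
  have left: "\<beta> (n \<otimes>\<^bsub>G\<^esub> g) = ga n (\<beta> g)" if "n \<in> N" "g \<in> carrier G" for n g
    using that E.Der_cD(4) [OF \<beta>, of n g] triv by simp
  have right: "\<beta> (g \<otimes>\<^bsub>G\<^esub> n) = \<beta> g" if "n \<in> N" "g \<in> carrier G" for n g
    using that E.Der_cD(4) [OF \<beta>, of g n] triv by simp
  have inv: "\<beta> (n \<otimes>\<^bsub>G\<^esub> g) = \<beta> g" if n: "n \<in> N" and g: "g \<in> carrier G" for n g
  proof -
    have "n \<otimes>\<^bsub>G\<^esub> g = g \<otimes>\<^bsub>G\<^esub> (inv\<^bsub>G\<^esub> g \<otimes>\<^bsub>G\<^esub> n \<otimes>\<^bsub>G\<^esub> g)"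
      using n g by (simp add: E.GR.G.word_simps)
    then show ?thesis using right [OF N.inv_op_closed1 [OF g n] g] by simp
  qed
  have AN: "\<beta> g \<in> AN" if "g \<in> carrier G" for g
    using that left inv by (simp add: fixed_points_def)
  have RN: "s \<in> RN"
  proof -
    have "gr n s = s" if n: "n \<in> N" for n
    proof -
      \<comment> \<open>Since \<beta>(n) is trivial, so is its image under \<mu>, which the cocycle
        condition identifies with \<open>s (ns)^-1\<close>.\<close>
      have "s \<otimes>\<^bsub>R\<^esub> inv\<^bsub>R\<^esub> (gr n s) = \<one>\<^bsub>R\<^esub>"
        using E.Der_cD(6) [OF \<beta>, of n] n triv by (simp add: E.GR.act_inv)
      then show ?thesis
        using n E.GR.E.inv_equality [of s "inv\<^bsub>R\<^esub> (gr n s)"] by simp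
    qed
    then show ?thesis by (simp add: fixed_points_def)
  qed
  define \<alpha> where "\<alpha> = (\<lambda>C\<in>carrier Q. the_elem (\<beta> ` C))"
  have \<alpha>: "\<alpha> (N #>\<^bsub>G\<^esub> g) = \<beta> g" if g: "g \<in> carrier G" for g
  proof -
    have "\<beta> ` (N #>\<^bsub>G\<^esub> g) = {\<beta> g}"
      using inv [OF _ g] E.GR.G.rcos_self [OF g N.subgroup_axioms]
      by (auto simp: r_coset_def)
    then show ?thesis using coset_in_Q [OF g] by (simp add: \<alpha>_def)
  qed
  have infl: "infl \<alpha> = \<beta>"
    using \<alpha> E.Der_cD(1) [OF \<beta>] by (auto simp: compose_def extensional_def)
  have "(\<alpha>, s) \<in> Der_c Q F"
  \<comment> \<open>Read from \<open>G\<close> to \<open>G/N\<close>: everything, continuity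
    included, is inherited from \<beta>.\<close>
  proof (subst Der_c_infl_iff [symmetric])
    show "\<alpha> \<in> extensional (carrier Q)" by (simp add: \<alpha>_def)
    show "\<alpha> C \<in> AN" if C: "C \<in> carrier Q" for C
      using C by (rule quotient_cases) (simp add: \<alpha> AN)
  qed (use RN \<beta> infl in auto)
  then show thesis using infl that by blast
qed

text \<open>The element \<open>a\<close> that trivialises \<alpha> on \<open>N\<close> also twists
  \<alpha> on all of \<open>G\<close>; this keeps the class and yields a cocycle that
  descends.\<close>

lemma kernel_Res1:
  assumes c: "c \<in> H1 G M" and base: "Res1 G N M c = H1_base S M"
  shows "c \<in> Inf1 G N M ` H1 Q F"
proof -
  obtain \<alpha> r where \<alpha>: "(\<alpha>, r) \<in> Der_c G M" "c = H1_class G M (\<alpha>, r)"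
    using c by (rule E.H1_cases)
  have "H1_class S M (restrict \<alpha> N, r) = H1_class S M (\<lambda>n\<in>carrier S. \<one>\<^bsub>A\<^esub>, \<one>\<^bsub>R\<^esub>)"
    using base by (simp add: \<alpha> Res1_class H1_base_def)
  then obtain a where a: "S.cohomologous_via a (restrict \<alpha> N) (\<lambda>n\<in>carrier S. \<one>\<^bsub>A\<^esub>)"
    using S.H1_class_eq_iff [OF Der_c_restrict [OF \<alpha>(1)] S.trivial_in_Der_c] by blast
  then have aA [simp]: "a \<in> carrier A" by (simp add: S.cohomologous_via_def)
  note [simp] = E.Der_cD(3,5) [OF \<alpha>(1)]
  define \<beta> where "\<beta> = (\<lambda>g\<in>carrier G. inv\<^bsub>A\<^esub> a \<otimes>\<^bsub>A\<^esub> \<alpha> g \<otimes>\<^bsub>A\<^esub> ga g a)"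
  \<comment> \<open>Applying \<mu> to the twisted cocycle shows that this \<open>s\<close> is a
    valid second component.\<close>
  define s where "s = inv\<^bsub>R\<^esub> (\<mu> a) \<otimes>\<^bsub>R\<^esub> r"
  have via: "E.cohomologous_via a \<alpha> \<beta>" by (simp add: E.cohomologous_via_def \<beta>_def)
  have \<beta>: "(\<beta>, s) \<in> Der_c G M"
  proof (rule E.Der_c_transfer [OF \<alpha>(1) via])
    have "continuous_map (topo G) (topo A) (\<lambda>g. inv\<^bsub>A\<^esub> a \<otimes>\<^bsub>A\<^esub> \<alpha> g \<otimes>\<^bsub>A\<^esub> ga g a)"
      using E.Der_cD(2) [OF \<alpha>(1)] by (intro GA.continuous_map_twist) auto
    then show "continuous_map (topo G) (topo A) \<beta>"
      by (rule continuous_map_eq) (simp add: \<beta>_def E.topspace_G)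
    show "\<mu> (\<beta> g) = s \<otimes>\<^bsub>R\<^esub> gr g (inv\<^bsub>R\<^esub> s)" if "g \<in> carrier G" for g
      using that E.Der_cD(6) [OF \<alpha>(1), of g]
      by (simp add: \<beta>_def s_def E.bmap_act E.GR.act_mult E.GR.act_inv E.GR.E.word_simps)
  qed (simp_all add: \<beta>_def s_def)
  have "\<beta> n = \<one>\<^bsub>A\<^esub>" if "n \<in> N" for n
    using a that by (simp add: S.cohomologous_via_def \<beta>_def)
  with \<beta> obtain \<gamma> where \<gamma>: "(\<gamma>, s) \<in> Der_c Q F" "infl \<gamma> = \<beta>"
    by (rule trivial_on_N_is_infl)
  have "c = H1_class G M (\<beta>, s)"
    using via E.H1_class_eq_iff [OF \<alpha>(1) \<beta>] \<alpha>(2) by blast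
  also have "\<dots> = Inf1 G N M (H1_class Q F (\<gamma>, s))"
    by (simp add: Inf1_class [OF \<gamma>(1)] \<gamma>(2))
  finally show ?thesis using Q.H1_class_in_H1 [OF \<gamma>(1)] by blast
qed

section \<open>Pointed maps and exactness\<close>

lemma pointed_map_Inf1: "pointed_map (H1_pointed Q F) (Inf1 G N M) (H1_pointed G M)"
proof -
  have "Inf1 G N M c \<in> H1 G M" if c: "c \<in> H1 Q F" for c
    using c by (rule Q.H1_cases) (simp add: Inf1_class infl_in_Der_c E.H1_class_in_H1)
  then show ?thesis
    by (auto simp: pointed_map_def H1_pointed_def Inf1_base Q.H1_base_in_H1 E.H1_base_in_H1)
qed

lemma pointed_map_Res1: "pointed_map (H1_pointed G M) (Res1 G N M) (H1_fixed_pointed G N M)"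
  using Res1_in_H1_fixed Res1_in_H1_fixed [OF E.H1_base_in_H1]
  by (simp add: pointed_map_def H1_pointed_def H1_fixed_pointed_def Res1_base E.H1_base_in_H1)

text \<open>The one-point set stands for the initial 1, so exactness says that inflation has trivial
  kernel; this follows from injectivity.\<close>

lemma exact_at_H1_quotient:
  "exact_at ({()}, ()) (\<lambda>_. H1_base Q F) (H1_pointed Q F) (Inf1 G N M) (H1_pointed G M)"
proof -
  have "c = H1_base Q F" if "c \<in> H1 Q F" "Inf1 G N M c = H1_base G M" for c
    using inj_onD [OF inj_on_Inf1] that Inf1_base Q.H1_base_in_H1 by metis
  then have "{c \<in> H1 Q F. Inf1 G N M c = H1_base G M} = {H1_base Q F}"
    using Q.H1_base_in_H1 Inf1_base by blast
  then show ?thesis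
    using pointed_map_Inf1 Q.H1_base_in_H1
    by (simp add: exact_at_def pointed_map_def H1_pointed_def)
qed

lemma exact_at_H1:
  "exact_at (H1_pointed Q F) (Inf1 G N M) (H1_pointed G M) (Res1 G N M) (H1_fixed_pointed G N M)"
  using pointed_map_Inf1 pointed_map_Res1 Res1_Inf1 kernel_Res1
  by (auto simp: exact_at_def pointed_map_def H1_pointed_def H1_fixed_pointed_def)

end

theorem theorem3p7:
  fixes G :: "'g topgroup" and N :: "'g set" and M :: "('g, 'r, 'a) bimodule"
  assumes "partially_crossed_bimodule G M"
    and "N \<lhd> G"
  shows "exact_at
           ({()}, ())
             (\<lambda>_. H1_base (quot_topgroup G N) (fixed_bimodule N M))
           (H1_pointed (quot_topgroup G N) (fixed_bimodule N M))
             (Inf1 G N M)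
           (H1_pointed G M)
       \<and> exact_at
           (H1_pointed (quot_topgroup G N) (fixed_bimodule N M))
             (Inf1 G N M)
           (H1_pointed G M)
             (Res1 G N M)
           (H1_fixed_pointed G N M)"
proof -
  interpret normal_bimodule G M N
    using assms partially_crossed_bimodule.equivariant_bimodule by (intro normal_bimodule.intro)
  show ?thesis using exact_at_H1_quotient exact_at_H1 ..
qed

end
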